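(* Let $\delta\geq 2$ be a squarefree integer. Then the real quadratic field $\mathbb{Q}[\sqrt{\delta}]$ contains infinitely many periodic continued fractions uniformly bounded by $4\lfloor\sqrt{\delta}\rfloor+1$, i.e. infinitely many real numbers $[\overline{a_0,a_1,\dots,a_n}]\in\mathbb{Q}[\sqrt{\delta}]$ with $1\le a_i\le 4\lfloor\sqrt{\delta}\rfloor+1$ for all $i$.
   Context: For positive integers $a_0,\dots,a_n$, $[\overline{a_0,\dots,a_n}]$ denotes the real number whose continued fraction expansion is purely periodic with period $(a_0,\dots,a_n)$. *)

theory Defs
  imports Complex_Main "HOL-Computational_Algebra.Squarefree"
begin

(* the finite continued fraction a 0 + 1 / (a 1 + 1 / (... + 1 / a n)) *)
primrec cfrac_convergent :: "nat \<Rightarrow> (nat \<Rightarrow> int) \<Rightarrow> real" where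
  "cfrac_convergent 0 a = of_int (a 0)"
| "cfrac_convergent (Suc n) a = of_int (a 0) + 1 / cfrac_convergent n (\<lambda>k. a (Suc k))"

definition has_cfrac_expansion :: "real \<Rightarrow> (nat \<Rightarrow> int) \<Rightarrow> bool" where
  "has_cfrac_expansion x a \<longleftrightarrow>
     (\<forall>k\<ge>1. a k \<ge> 1) \<and> (\<lambda>n. cfrac_convergent n a) \<longlonglongrightarrow> x"

(* The period need not be minimal. *)
definition has_periodic_cfrac :: "real \<Rightarrow> int list \<Rightarrow> bool" where
  "has_periodic_cfrac x as \<longleftrightarrow>
     as \<noteq> [] \<and> has_cfrac_expansion x (\<lambda>k. as ! (k mod length as))"

definition quadratic_field :: "int \<Rightarrow> real set" where
  "quadratic_field \<delta> = {p + q * sqrt (of_int \<delta>) | p q. p \<in> \<rat> \<and> q \<in> \<rat>}"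

end

theory Submission
  imports Defs "HOL-Analysis.Kronecker_Approximation_Theorem"
begin

text \<open>Let \<open>U = (p, \<delta>q; q, p)\<close> come from a solution \<open>p\<^sup>2 - \<delta>q\<^sup>2 = 1\<close> of Pell's equation and let
  \<open>p / q = [s; w]\<close> with \<open>s = \<lfloor>\<surd>\<delta>\<rfloor>\<close>. A digit \<open>c\<close> of \<open>w\<close> following the convergent \<open>P / k\<close> forces
  \<open>|P\<^sup>2 - \<delta>k\<^sup>2|\<close> to be roughly at most \<open>2 (s + 1) / c\<close>; as this is a positive integer, all digits
  are at most \<open>2s + 2\<close>. The geodesic from \<open>\<surd>\<delta> + 2\<close> to \<open>\<surd>\<delta>\<close> can be closed up by following the
  axis of \<open>U\<close>, turning around, and following it back, which gives the period
  \<open>w, s - 1, 1, 1, s, w'\<close>, where \<open>w'\<close> is \<open>w\<close> with its last digit \<open>l\<close> replaced by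
  \<open>l - 1, 1, 1\<close>. Its matrix is conjugate to \<open>U R U R'\<close> with involutions \<open>R\<close>, \<open>R'\<close> for which
  the trace is \<open>2 (p\<^sup>2 + \<delta>q\<^sup>2)\<close>, so the discriminant is \<open>\<delta> (4pq)\<^sup>2\<close> and the value lies in
  the field. Different solutions \<open>(p, q)\<close> give different values.\<close>

section \<open>Continued fractions and integer matrices\<close>

datatype mat2 = Mat2 int int int int

instantiation mat2 :: monoid_mult
begin

definition one_mat2 :: mat2 where
  "1 = Mat2 1 0 0 1"

fun times_mat2 :: "mat2 \<Rightarrow> mat2 \<Rightarrow> mat2" where
  "Mat2 a b c d * Mat2 a' b' c' d' =
     Mat2 (a * a' + b * c') (a * b' + b * d') (c * a' + d * c') (c * b' + d * d')"

instance
proof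
  fix x y z :: mat2
  show "x * y * z = x * (y * z)"
    by (cases x; cases y; cases z) (simp add: algebra_simps)
  show "1 * x = x" "x * 1 = x"
    by (cases x; simp add: one_mat2_def)+
qed

end

text \<open>As a Moebius map this is \<open>t \<mapsto> a + 1 / t\<close>, so products of such
  matrices prepend words of digits.\<close>

definition digit_mat :: "int \<Rightarrow> mat2" where
  "digit_mat a = Mat2 a 1 1 0"

definition word_mat :: "int list \<Rightarrow> mat2" where
  "word_mat as = prod_list (map digit_mat as)"

lemma word_mat_Nil [simp]: "word_mat [] = 1"
  and word_mat_Cons [simp]: "word_mat (a # as) = digit_mat a * word_mat as"
  and word_mat_append [simp]: "word_mat (as @ bs) = word_mat as * word_mat bs"
  by (simp_all add: word_mat_def)

text \<open>Every digit matrix has determinant -1, hence the unit determinant;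
  \<open>c + d \<ge> 1\<close> keeps denominators \<open>c * t + d\<close> positive for
  \<open>t > 0\<close>.\<close>

lemma word_mat_props:
  assumes "word_mat as = Mat2 a b c d" "\<forall>x\<in>set as. 1 \<le> x"
  shows "a \<ge> 1" "b \<ge> 0" "c \<ge> 0" "d \<ge> 0" "c + d \<ge> 1" "\<bar>a * d - b * c\<bar> = 1"
proof -
  have "a \<ge> 1 \<and> b \<ge> 0 \<and> c \<ge> 0 \<and> d \<ge> 0 \<and> c + d \<ge> 1 \<and> \<bar>a * d - b * c\<bar> = 1"
    using assms
  proof (induction as arbitrary: a b c d)
    case Nil
    then show ?case by (simp add: one_mat2_def)
  next
    case (Cons x as)
    obtain a' b' c' d' where m: "word_mat as = Mat2 a' b' c' d'"
      by (cases "word_mat as")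
    have IH: "a' \<ge> 1" "b' \<ge> 0" "c' \<ge> 0" "d' \<ge> 0" "\<bar>a' * d' - b' * c'\<bar> = 1"
      using Cons.IH[OF m] Cons.prems by auto
    have eq: "a = x * a' + c'" "b = x * b' + d'" "c = a'" "d = b'"
      using Cons.prems(1)
    unfolding word_mat_Cons m digit_mat_def times_mat2.simps mat2.inject mult_1 mult_zero_left
      add_0_right
    by blast+
    have x: "x \<ge> 1" using Cons.prems by simp
    have "1 * 1 \<le> x * a'" "0 \<le> x * b'"
      using IH x mult_mono[of 1 x 1 a'] by simp_all
    then have "a \<ge> 1" "b \<ge> 0" "c \<ge> 0" "d \<ge> 0" "c + d \<ge> 1" using IH eq by linarith+
    moreover have "a * d - b * c = - (a' * d' - b' * c')"
      unfolding eq by (simp add: algebra_simps)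
    then have "\<bar>a * d - b * c\<bar> = 1" using IH(5) by (simp only: abs_minus_cancel)
    ultimately show ?case by blast
  qed
  then show "a \<ge> 1" "b \<ge> 0" "c \<ge> 0" "d \<ge> 0" "c + d \<ge> 1" "\<bar>a * d - b * c\<bar> = 1"
    by auto
qed

section \<open>Periodic continued fractions as fixed points of words\<close>

primrec cfrac_apply :: "int list \<Rightarrow> real \<Rightarrow> real" where
  "cfrac_apply [] t = t"
| "cfrac_apply (a # as) t = of_int a + 1 / cfrac_apply as t"

lemma cfrac_apply_pos:
  assumes "\<forall>x\<in>set as. 1 \<le> x" "t > 0"
  shows "cfrac_apply as t > 0"
  using assms
proof (induction as)
  case (Cons x as)
  then have "1 / cfrac_apply as t > 0" "(of_int x :: real) \<ge> 1"
    by auto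
  then show ?case by (simp del: zero_less_divide_1_iff)
qed simp

lemma cfrac_apply_word_mat:
  assumes "word_mat as = Mat2 a b c d" "\<forall>x\<in>set as. 1 \<le> x" "t > 0"
  shows "cfrac_apply as t = (of_int a * t + of_int b) / (of_int c * t + of_int d)"
  using assms
proof (induction as arbitrary: a b c d)
  case Nil
  then show ?case by (simp add: one_mat2_def)
next
  case (Cons x as)
  obtain a' b' c' d' where m: "word_mat as = Mat2 a' b' c' d'"
    by (cases "word_mat as")
  note pr = word_mat_props[OF m]
  have ge: "a' \<ge> 1" "b' \<ge> 0" using pr Cons.prems by auto
  have eq: "a = x * a' + c'" "b = x * b' + d'" "c = a'" "d = b'"
    using Cons.prems(1)
    unfolding word_mat_Cons m digit_mat_def times_mat2.simps mat2.inject mult_1 mult_zero_left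
      add_0_right
    by blast+
  have IH: "cfrac_apply as t = (of_int a' * t + of_int b') / (of_int c' * t + of_int d')"
    using Cons.IH[OF m] Cons.prems by simp
  have "of_int a' * t > 0" using ge Cons.prems by simp
  then have pos: "of_int a' * t + of_int b' > 0" using ge by (simp add: add_pos_nonneg)
  have "cfrac_apply (x # as) t = of_int x + (of_int c' * t + of_int d') / (of_int a' * t + of_int b')"
    by (simp add: IH)
  also have "\<dots> = (of_int a * t + of_int b) / (of_int c * t + of_int d)"
    using pos unfolding eq by (simp add: field_simps)
  finally show ?case .
qed

lemma cfrac_convergent_ge_1:
  assumes "\<forall>k. a k \<ge> 1"
  shows "cfrac_convergent n a \<ge> 1"
  using assms
proof (induction n arbitrary: a)
  case 0
  then show ?case by simp
next
  case (Suc n)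
  have "cfrac_convergent n (\<lambda>k. a (Suc k)) \<ge> 1"
    using Suc by simp
  moreover have "(of_int (a 0) :: real) \<ge> 1" using Suc.prems by simp
  ultimately show ?case by (simp add: add_increasing2)
qed

text \<open>One step of the expansion need not contract, but \<open>x\<^sub>1 x\<^sub>2 = a\<^sub>1 x\<^sub>2 + 1 \<ge> 2\<close> makes
  two steps contract by a factor \<open>1 / 4\<close>.\<close>

lemma cfrac_convergent_error:
  fixes a :: "nat \<Rightarrow> int" and x :: "nat \<Rightarrow> real"
  assumes "\<forall>k. a k \<ge> 1" "\<forall>k. x k \<ge> 1" "\<forall>k. x k = of_int (a k) + 1 / x (Suc k)"
  shows "\<bar>cfrac_convergent n a - x 0\<bar> \<le> (1 / 4) ^ (n div 2)"
  using assms
proof (induction n arbitrary: a x rule: less_induct)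
  case (less n)
  note a = less.prems(1)[rule_format] and x = less.prems(2)[rule_format]
    and rec = less.prems(3)[rule_format]
  consider "n = 0" | "n = 1" | m where "n = Suc (Suc m)"
    by (metis One_nat_def not0_implies_Suc)
  then show ?case
  proof cases
    case 1
    then show ?thesis using rec[of 0] x[of 1] by simp
  next
    case 2
    have "1 / of_int (a 1) \<le> (1::real)" "1 / x 1 \<le> 1" "1 / of_int (a 1) \<ge> (0::real)" "1 / x 1 \<ge> 0"
      using a[of 1] x[of 1] by (auto simp: divide_simps)
    then have "\<bar>1 / of_int (a 1) - 1 / x 1\<bar> \<le> 1" by linarith
    then show ?thesis by (simp add: 2 rec[of 0])
  next
    case 3
    define y where "y = cfrac_convergent m (\<lambda>k. a (Suc (Suc k)))"
    have y: "y \<ge> 1" unfolding y_def using a by (intro cfrac_convergent_ge_1) auto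
    have "\<bar>y - x (Suc (Suc 0))\<bar> \<le> (1 / 4) ^ (m div 2)"
      unfolding y_def
    proof (rule less.IH[of m _ "\<lambda>k. x (Suc (Suc k))"])
      show "\<forall>k. x (Suc (Suc k)) = of_int (a (Suc (Suc k))) + 1 / x (Suc (Suc (Suc k)))"
        using rec by blast
    qed (use 3 a x in simp_all)
    then have IH: "\<bar>y - x 2\<bar> \<le> (1 / 4) ^ (m div 2)" by (simp only: numeral_2_eq_2[symmetric])
    define b :: real where "b = of_int (a 1)"
    have b: "b \<ge> 1" unfolding b_def using a[of 1] by simp
    have x2: "x 2 \<ge> 1" using x by simp
    have x1: "x 1 = b + 1 / x 2" using rec[of 1] by (simp add: b_def numeral_2_eq_2)
    have "cfrac_convergent n a - x 0 = 1 / (b + 1 / y) - 1 / (b + 1 / x 2)"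
      using 3 rec[of 0] x1 by (simp add: y_def b_def)
    also have "\<dots> = y / (b * y + 1) - x 2 / (b * x 2 + 1)"
      using y x2 b by (simp add: field_simps)
    also have "\<dots> = (y - x 2) / ((b * y + 1) * (b * x 2 + 1))"
    proof -
      have "b * y > 0" "b * x 2 > 0" using b y x2 by simp_all
      then have "b * y + 1 \<noteq> 0" "b * x 2 + 1 \<noteq> 0" by linarith+
      then show ?thesis by (simp add: field_simps)
    qed
    finally have eq: "cfrac_convergent n a - x 0 = (y - x 2) / ((b * y + 1) * (b * x 2 + 1))" .
    have "1 * 1 \<le> b * y" "1 * 1 \<le> b * x 2"
      using b y x2 by (intro mult_mono; simp)+
    then have "2 * 2 \<le> (b * y + 1) * (b * x 2 + 1)"
      by (intro mult_mono) auto
    then have den: "4 \<le> \<bar>(b * y + 1) * (b * x 2 + 1)\<bar>" by linarith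
    have "\<bar>cfrac_convergent n a - x 0\<bar> = \<bar>y - x 2\<bar> / \<bar>(b * y + 1) * (b * x 2 + 1)\<bar>"
      unfolding eq by (simp add: abs_divide)
    also have "\<dots> \<le> (1 / 4) ^ (m div 2) / 4"
      using IH den by (intro frac_le) auto
    also have "\<dots> = (1 / 4) ^ (n div 2)" using 3 by simp
    finally show ?thesis .
  qed
qed

text \<open>A positive fixed point of the word has a periodic sequence of complete quotients, to
  which \<open>cfrac_convergent_error\<close> applies.\<close>

lemma has_periodic_cfracI:
  assumes "as \<noteq> []" "\<forall>a\<in>set as. 1 \<le> a" "x > 0" "cfrac_apply as x = x"
  shows "has_periodic_cfrac x as"
proof -
  define L where "L = length as"
  have L: "L > 0" using assms(1) by (simp add: L_def)
  define a where "a k = as ! (k mod L)" for k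
  \<comment> \<open>The complete quotients: the rest of the current period, followed by
    \<open>x\<close>.\<close>
  define X where "X k = cfrac_apply (drop (k mod L) as) x" for k
  have a: "\<forall>k. a k \<ge> 1"
    using assms(2) L by (simp add: a_def L_def)
  have Xpos: "X k > 0" for k
    unfolding X_def using assms(2,3) by (intro cfrac_apply_pos) (auto dest: in_set_dropD)
  have rec: "\<forall>k. X k = of_int (a k) + 1 / X (Suc k)"
  proof
    fix k
    have lt: "k mod L < length as" using L by (simp add: L_def)
    have "X k = of_int (a k) + 1 / cfrac_apply (drop (Suc (k mod L)) as) x"
      unfolding X_def a_def Cons_nth_drop_Suc[OF lt, symmetric] by simp
    \<comment> \<open>At the end of a period the remaining word is empty and leaves
      \<open>x\<close>, while \<open>X (Suc k)\<close> starts a full period; the fixed-point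
      equation identifies the two.\<close>
    also have "cfrac_apply (drop (Suc (k mod L)) as) x = X (Suc k)"
    proof (cases "Suc (k mod L) = L")
      case True
      then have "Suc k mod L = 0" by (simp add: mod_Suc)
      then show ?thesis using True assms(4) by (simp add: X_def L_def)
    next
      case False
      then show ?thesis by (simp add: X_def mod_Suc)
    qed
    finally show "X k = of_int (a k) + 1 / X (Suc k)" .
  qed
  have X1: "\<forall>k. X k \<ge> 1"
  proof
    fix k
    have "(of_int (a k) :: real) \<ge> 1" using a by simp
    moreover have "1 / X (Suc k) > 0" using Xpos by simp
    ultimately show "X k \<ge> 1" using rec[rule_format, of k] by linarith
  qed
  have X0: "X 0 = x" using assms(4) by (simp add: X_def)
  have "(\<lambda>n. cfrac_convergent n a - x) \<longlonglongrightarrow> 0"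
  proof (rule Lim_null_comparison)
    show "\<forall>\<^sub>F n in sequentially. norm (cfrac_convergent n a - x) \<le> (1 / 4) ^ (n div 2)"
      using cfrac_convergent_error[OF a X1 rec] X0 by simp
    have "filterlim (\<lambda>n::nat. n div 2) at_top at_top"
      unfolding filterlim_at_top eventually_sequentially
    proof (intro allI exI impI)
      fix m n :: nat
      assume "2 * m \<le> n"
      then show "m \<le> n div 2" by simp
    qed
    then show "(\<lambda>n. (1 / 4 :: real) ^ (n div 2)) \<longlonglongrightarrow> 0"
      by (rule filterlim_compose[rotated]) (simp add: LIMSEQ_power_zero)
  qed
  then have "(\<lambda>n. cfrac_convergent n a) \<longlonglongrightarrow> x"
    by (simp add: LIM_zero_iff)
  then show ?thesis
    using a assms(1) unfolding has_periodic_cfrac_def has_cfrac_expansion_def a_def L_def by simp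
qed

text \<open>Euclid's algorithm on the first column: splitting off the digit \<open>a div c\<close>
  leaves \<open>(c, d; r, e)\<close> with \<open>r < c\<close>, and the unit determinant carries the
  inequalities between the entries over to it.\<close>

lemma ex_word_mat:
  fixes a b c d :: int
  assumes "\<bar>a * d - b * c\<bar> = 1" "b \<le> a" "c \<le> a" "d \<le> b" "d \<le> c" "0 \<le> d" "1 \<le> c"
  shows "\<exists>as. word_mat as = Mat2 a b c d \<and> (\<forall>x\<in>set as. 1 \<le> x)"
  using assms
proof (induction "nat c" arbitrary: a b c d rule: less_induct)
  case less
  \<comment> \<open>The first two cases end the algorithm: the determinant forces
    \<open>(a, 1; 1, 0)\<close> or \<open>(b + 1, b; 1, 1)\<close>, the words \<open>[a]\<close> and
    \<open>[b, 1]\<close>.\<close>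
  consider "d = 0" | "d \<ge> 1" "c = d" | "d \<ge> 1" "c > d"
    using less.prems by linarith
  then show ?case
  proof cases
    case 1
    then have "\<bar>b * c\<bar> = 1" using less.prems by simp
    then have "\<bar>c\<bar> = 1" "\<bar>b\<bar> = 1" by (auto simp: abs_mult zmult_eq_1_iff)
    then have "c = 1" "b = 1" using less.prems 1 by auto
    then show ?thesis using 1 less.prems
      by (intro exI[of _ "[a]"]) (simp add: digit_mat_def one_mat2_def)
  next
    case 2
    then have "\<bar>(a - b) * c\<bar> = 1" using less.prems by (simp add: algebra_simps)
    then have "\<bar>c\<bar> = 1" "\<bar>a - b\<bar> = 1" by (auto simp: abs_mult zmult_eq_1_iff)
    then have "c = 1" "d = 1" "a = b + 1" using less.prems 2 by auto
    then show ?thesis using less.prems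
      by (intro exI[of _ "[b, 1]"]) (simp add: digit_mat_def one_mat2_def)
  next
    case 3
    define k where "k = a div c"
    define r where "r = a mod c"
    define e where "e = b - k * d"
    have c: "c > 1" using 3 by simp
    have ar: "a = k * c + r" by (simp add: k_def r_def)
    have r: "0 \<le> r" "r < c" using c by (simp_all add: r_def)
    have k: "k \<ge> 1" using less.prems c by (simp add: k_def pos_imp_zdiv_pos_iff int_one_le_iff_zero_less)
    have det: "\<bar>r * d - e * c\<bar> = 1"
      using less.prems(1) by (simp add: ar e_def algebra_simps)
    have "r \<noteq> 0"
    proof
      assume "r = 0"
      then have "\<bar>e * c\<bar> = 1" using det by simp
      then show False using c by (auto simp: abs_mult zmult_eq_1_iff)
    qed
    then have r1: "1 \<le> r" using r by simp
    have rd: "1 * 1 \<le> r * d" using r1 3 by (intro mult_mono) auto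
    have "0 \<le> e * c" using det rd by linarith
    then have e0: "0 \<le> e" using c by (simp add: zero_le_mult_iff)
    \<comment> \<open>The error 1 of the determinant is absorbed by \<open>r \<le> c - 1\<close>
      here and by \<open>d \<le> c - 1\<close> in the bound \<open>e \<le> r\<close> below.\<close>
    have "e * c \<le> r * d + 1" using det by linarith
    also have "r * d \<le> (c - 1) * d" using r 3 by (intro mult_right_mono) auto
    finally have "e * c \<le> d * c + (1 - d)" by (simp add: algebra_simps)
    then have "e * c \<le> d * c" using 3 by linarith
    then have ed: "e \<le> d" using c by simp
    have "e * c \<le> r * d + 1" using det by linarith
    also have "r * d \<le> r * (c - 1)" using r 3 by (intro mult_left_mono) auto
    finally have "e * c \<le> r * c + (1 - r)" by (simp add: algebra_simps)
    then have "e * c \<le> r * c" using r1 by linarith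
    then have er: "e \<le> r" using c by simp
    have det': "\<bar>c * e - d * r\<bar> = 1" using det by (simp add: algebra_simps abs_minus_commute)
    obtain as where as: "word_mat as = Mat2 c d r e" "\<forall>x\<in>set as. 1 \<le> x"
      using less.hyps[of r c e d] det' r r1 ed er e0 3 by auto
    have "word_mat (k # as) = Mat2 a b c d"
      using as by (simp add: digit_mat_def e_def ar algebra_simps)
    then show ?thesis using as k by (intro exI[of _ "k # as"]) simp
  qed
qed

section \<open>The expansion attached to a solution of Pell's equation\<close>

lemma squarefree_imp_not_square_ratio:
  fixes \<delta> h k :: int
  assumes "\<delta> \<ge> 2" "squarefree \<delta>" "k \<noteq> 0"
  shows "h\<^sup>2 \<noteq> \<delta> * k\<^sup>2"
proof
  assume eq: "h\<^sup>2 = \<delta> * k\<^sup>2"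
  then have "k\<^sup>2 dvd h\<^sup>2" by simp
  then have "k dvd h" by simp
  then obtain m where m: "h = k * m" by blast
  then have "\<delta> = m\<^sup>2" using eq assms(3) by (simp add: power_mult_distrib)
  moreover from this have "m dvd 1" using assms(2) by (intro squarefreeD[of \<delta> m]) auto
  then have "m\<^sup>2 = 1" by (metis power2_abs one_power2 zdvd1_eq)
  ultimately show False using assms(1) by simp
qed

text \<open>The conditions on \<open>s\<close> express that it is the integer part of the square
  root of \<delta>. The bound \<open>q \<ge> 3\<close> excludes the words \<open>[]\<close> and
  \<open>[1]\<close> for \<open>core\<close> and leaves room in the positivity estimate for the
  value.\<close>

locale pell =
  fixes \<delta> s p q :: int
  assumes nonsquare: "\<And>h k. k \<noteq> 0 \<Longrightarrow> h\<^sup>2 \<noteq> \<delta> * k\<^sup>2"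
    and s_pos: "s \<ge> 1" and s_le: "s\<^sup>2 \<le> \<delta>" and s_less: "\<delta> < (s + 1)\<^sup>2"
    and p_pos: "p > 0" and q_ge: "q \<ge> 3" and pell: "p\<^sup>2 - \<delta> * q\<^sup>2 = 1"
begin

text \<open>Integrality gives \<open>\<delta> \<le> (s + 1)\<^sup>2 - 1\<close>; the slack
  \<open>q\<^sup>2\<close> absorbs the 1 in Pell's equation.\<close>

lemma p_upper: "p \<le> (s + 1) * q"
proof -
  have "\<delta> * q\<^sup>2 \<le> ((s + 1)\<^sup>2 - 1) * q\<^sup>2" using s_less by (intro mult_right_mono) simp_all
  moreover have "0 < q\<^sup>2" using q_ge by simp
  moreover have "((s + 1)\<^sup>2 - 1) * q\<^sup>2 = ((s + 1) * q)\<^sup>2 - q\<^sup>2"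
    by (simp only: power_mult_distrib left_diff_distrib mult_1)
  ultimately have A: "p\<^sup>2 \<le> ((s + 1) * q)\<^sup>2"
    using pell by linarith
  have "0 \<le> (s + 1) * q" using s_pos q_ge by simp
  with A show ?thesis by (rule power2_le_imp_le)
qed

lemma p_lower: "s * q < p"
proof -
  have "s\<^sup>2 * q\<^sup>2 \<le> \<delta> * q\<^sup>2" using s_le by (intro mult_right_mono) simp_all
  then have "(s * q)\<^sup>2 < p\<^sup>2" unfolding power_mult_distrib using pell by linarith
  moreover have "0 \<le> p" using p_pos by simp
  ultimately show ?thesis by (rule power2_less_imp_less)
qed

text \<open>The matrix \<open>U = (p, \<delta>q; q, p)\<close> fixes \<open>\<surd>\<delta>\<close>, and \<open>U = (s, 1; 1, 0) core (1, s; 0, 1)\<close>.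
  Hence \<open>p / q = [s; w]\<close> for the word \<open>w\<close> of \<open>core\<close>.\<close>

definition core :: mat2 where
  "core = Mat2 q (p - s * q) (p - s * q) (\<delta> * q - 2 * s * p + s\<^sup>2 * q)"

lemma core_det: "q * (\<delta> * q - 2 * s * p + s\<^sup>2 * q) = (p - s * q)\<^sup>2 - 1"
proof -
  have "q * (\<delta> * q - 2 * s * p + s\<^sup>2 * q) = (p - s * q)\<^sup>2 - (p\<^sup>2 - \<delta> * q\<^sup>2)"
    by (simp add: power2_eq_square algebra_simps)
  then show ?thesis unfolding pell .
qed

lemma ex_core_word: "\<exists>w. word_mat w = core \<and> (\<forall>x\<in>set w. 1 \<le> x)"
proof -
  define a where "a = p - s * q"
  define y where "y = \<delta> * q - 2 * s * p + s\<^sup>2 * q"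
  have a: "1 \<le> a" "a \<le> q" using p_upper p_lower by (auto simp: a_def algebra_simps)
  \<comment> \<open>This is \<open>det core = -1\<close>; sign and size of \<open>y\<close> are read
    off from it.\<close>
  have qy: "q * y = a * a - 1" using core_det by (simp add: a_def y_def power2_eq_square)
  have "1 * 1 \<le> a * a" using a by (intro mult_mono) auto
  then have "0 \<le> q * y" using qy by simp
  then have y0: "0 \<le> y" using q_ge by (simp add: zero_le_mult_iff)
  have "a * a \<le> q * a" using a by (intro mult_right_mono) auto
  then have "q * y \<le> q * a" using qy by simp
  then have ya: "y \<le> a" using q_ge by simp
  have "\<bar>q * y - a * a\<bar> = 1" using qy by simp
  then show ?thesis
    unfolding core_def a_def[symmetric] y_def[symmetric]
    using ex_word_mat[of q y a a] a y0 ya by auto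
qed

lemma core_word_digit_le:
  assumes w: "word_mat w = core" "\<forall>x\<in>set w. 1 \<le> x" and c: "c \<in> set w"
  shows "c \<le> 2 * s + 2"
proof -
  obtain u v where uv: "w = u @ c # v" using c by (meson split_list)
  obtain k k' l l' where u: "word_mat u = Mat2 k k' l l'" by (cases "word_mat u")
  obtain m m' t t' where v: "word_mat v = Mat2 m m' t t'" by (cases "word_mat v")
  have c1: "1 \<le> c" using w c by auto
  have ku: "k \<ge> 1" "k' \<ge> 0" "l \<ge> 0" "l' \<ge> 0" "\<bar>k * l' - k' * l\<bar> = 1"
    using word_mat_props[OF u] w uv by auto
  have mv: "m \<ge> 1" "t \<ge> 0"
    using word_mat_props[OF v] w uv by auto
  have "core = Mat2 k k' l l' * (Mat2 c 1 1 0 * Mat2 m m' t t')"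
    using w(1) uv u v by (simp add: digit_mat_def)
  then have q_eq: "q = k * (c * m + t) + k' * m" and a_eq: "p - s * q = l * (c * m + t) + l' * m"
    unfolding core_def times_mat2.simps mat2.inject mult_1 mult_zero_left add_0_right by blast+
  \<comment> \<open>For the convergent \<open>P / k = [s; u]\<close>, where
    \<open>P = s * k + l\<close>, this is \<open>p * k - q * P\<close>. The unit determinant of the
    prefix gives \<open>\<bar>e\<bar> = m\<close>.\<close>
  define e where "e = (p - s * q) * k - q * l"
  have "e = (k * l' - k' * l) * m"
    unfolding e_def a_eq unfolding q_eq by (simp add: algebra_simps)
  then have e: "\<bar>e\<bar> = m" using ku mv by (simp add: abs_mult)
  then have e2: "e\<^sup>2 = m\<^sup>2" by (metis power2_abs)
  define P where "P = s * k + l"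
  have "P\<^sup>2 \<noteq> \<delta> * k\<^sup>2" using nonsquare ku by simp
  then have "1 \<le> \<bar>P\<^sup>2 - \<delta> * k\<^sup>2\<bar>" by linarith
  \<comment> \<open>After scaling by \<open>q\<^sup>2\<close>, Pell's equation replaces
    \<open>\<delta> * q\<^sup>2\<close> by \<open>p\<^sup>2 - 1\<close>, and only \<open>e\<close>,
    \<open>p\<close> and \<open>k\<close> remain.\<close>
  then have "q\<^sup>2 * 1 \<le> q\<^sup>2 * \<bar>P\<^sup>2 - \<delta> * k\<^sup>2\<bar>" by (intro mult_left_mono) auto
  also have "\<dots> = \<bar>(q * P)\<^sup>2 - (\<delta> * q\<^sup>2) * k\<^sup>2\<bar>"
  proof -
    have "(q * P)\<^sup>2 - (\<delta> * q\<^sup>2) * k\<^sup>2 = q\<^sup>2 * (P\<^sup>2 - \<delta> * k\<^sup>2)"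
      by (simp add: algebra_simps power_mult_distrib)
    then show ?thesis by (simp add: abs_mult)
  qed
  also have "(q * P)\<^sup>2 - (\<delta> * q\<^sup>2) * k\<^sup>2 = e\<^sup>2 - 2 * e * (p * k) + k\<^sup>2"
  proof -
    have qP: "q * P = p * k - e" by (simp add: P_def e_def algebra_simps)
    have dq: "\<delta> * q\<^sup>2 = p\<^sup>2 - 1" using pell by simp
    show ?thesis unfolding qP dq by (simp add: power2_eq_square algebra_simps)
  qed
  also have "\<bar>e\<^sup>2 - 2 * e * (p * k) + k\<^sup>2\<bar> \<le> m\<^sup>2 + 2 * m * (p * k) + k\<^sup>2"
  proof -
    have "\<bar>2 * e * (p * k)\<bar> = 2 * m * (p * k)"
      using e p_pos ku by (simp add: abs_mult)
    then show ?thesis using e2 zero_le_power2[of m] zero_le_power2[of k] by linarith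
  qed
  finally have main: "q\<^sup>2 \<le> m\<^sup>2 + 2 * m * (p * k) + k\<^sup>2" by simp
  have "0 \<le> k * t" "0 \<le> k' * m" using ku mv by simp_all
  then have ckm: "c * k * m \<le> q" unfolding q_eq by (simp add: algebra_simps)
  have "c * k * 1 \<le> c * k * m" "1 * (c * m) \<le> k * (c * m)"
    using ku mv c1 by (intro mult_left_mono mult_right_mono; simp)+
  then have ck: "c * k \<le> q" and cm: "c * m \<le> q" using ckm by (simp_all add: algebra_simps)
  \<comment> \<open>Since \<open>c * m\<close>, \<open>c * k\<close> and \<open>c * k * m\<close>
    are all at most \<open>q\<close>, this gives \<open>c\<^sup>2 \<le> 2 + 2 * c * (s + 1)\<close>
    once \<open>q\<^sup>2\<close> is cancelled.\<close>
  have "c\<^sup>2 * q\<^sup>2 \<le> c\<^sup>2 * (m\<^sup>2 + 2 * m * (p * k) + k\<^sup>2)"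
    using main by (intro mult_left_mono) auto
  also have "\<dots> = (c * m)\<^sup>2 + 2 * c * p * (c * k * m) + (c * k)\<^sup>2"
    by (simp add: power2_eq_square algebra_simps)
  also have "\<dots> \<le> q\<^sup>2 + 2 * c * p * q + q\<^sup>2"
  proof (intro add_mono)
    show "(c * m)\<^sup>2 \<le> q\<^sup>2" "(c * k)\<^sup>2 \<le> q\<^sup>2"
      using ck cm c1 ku mv by (intro power_mono; simp)+
    show "2 * c * p * (c * k * m) \<le> 2 * c * p * q"
      using ckm c1 p_pos by (intro mult_left_mono) auto
  qed
  also have "2 * c * p * q \<le> 2 * c * ((s + 1) * q) * q"
    using p_upper c1 q_ge by (intro mult_left_mono mult_right_mono) auto
  finally have "c\<^sup>2 * q\<^sup>2 \<le> (2 + 2 * c * (s + 1)) * q\<^sup>2"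
    by (simp add: power2_eq_square algebra_simps)
  then have c2: "c * c \<le> 2 + 2 * c * (s + 1)" using q_ge by (simp add: power2_eq_square)
  show ?thesis
  proof (rule ccontr)
    assume "\<not> ?thesis"
    then have gt: "c \<ge> 2 * s + 3" by simp
    then have "c * (2 * s + 3) \<le> c * c" using c1 by (intro mult_left_mono) auto
    then have "c \<le> 2" using c2 by (simp add: algebra_simps)
    then show False using gt s_pos by simp
  qed
qed

end

section \<open>Turning words and the assembled period\<close>

text \<open>The digit \<open>0\<close> is removed by \<open>(a, 1; 1, 0) (0, 1; 1, 0) (b, 1; 1, 0) = (a + b, 1; 1, 0)\<close>;
  it arises in the first turn \<open>s - 1, 1, 1, s\<close> if \<open>s = 1\<close> and in the second turn
  \<open>l - 1, 1, 1\<close> if the last digit \<open>l\<close> of the word is \<open>1\<close>.\<close>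

lemma ex_word_first_turn:
  assumes "w \<noteq> []" "\<forall>x\<in>set w. 1 \<le> x \<and> x \<le> B" "1 \<le> s" "s \<le> B"
  shows "\<exists>w'. word_mat w' = word_mat w * word_mat [s - 1, 1, 1, s] \<and> w' \<noteq> [] \<and>
    (\<forall>x\<in>set w'. 1 \<le> x \<and> x \<le> B + 1)"
proof (cases "s = 1")
  case True
  \<comment> \<open>Here \<open>[l, 0, 1, 1, 1]\<close> merges to \<open>[l + 1, 1, 1]\<close>,
    which is why the bound grows to \<open>B + 1\<close>.\<close>
  obtain w0 l where w: "w = w0 @ [l]" using assms(1) by (meson rev_exhaust)
  show ?thesis
    using assms w True
    by (intro exI[of _ "w0 @ [l + 1, 1, 1]"])
       (auto simp: digit_mat_def one_mat2_def mult.assoc algebra_simps)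
next
  case False
  have "\<forall>x\<in>set w. 1 \<le> x \<and> x \<le> B + 1" using assms(2) by force
  then show ?thesis
    using assms False by (intro exI[of _ "w @ [s - 1, 1, 1, s]"]) simp
qed

lemma ex_word_second_turn:
  assumes "\<forall>x\<in>set w. 1 \<le> x \<and> x \<le> B" "w \<noteq> []" "w \<noteq> [1]"
  shows "\<exists>w'. word_mat w' = word_mat w * Mat2 2 1 (-1) 0 \<and>
    (\<forall>x\<in>set w'. 1 \<le> x \<and> x \<le> B + 1)"
proof -
  \<comment> \<open>Right multiplication by \<open>Mat2 2 1 (-1) 0\<close> turns
    \<open>digit_mat l\<close> into the matrix of \<open>[l - 1, 1, 1]\<close>, whatever
    \<open>l\<close> is. For \<open>l = 1\<close> the ending \<open>[k, 0, 1, 1]\<close> merges to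
    \<open>[k + 1, 1]\<close>.\<close>
  obtain w0 l where w: "w = w0 @ [l]" using assms(2) by (meson rev_exhaust)
  show ?thesis
  proof (cases "l = 1")
    case True
    then obtain w1 k where w0: "w0 = w1 @ [k]" using assms(3) w by (metis append_Nil rev_exhaust)
    show ?thesis
      using assms w w0 True
      by (intro exI[of _ "w1 @ [k + 1, 1]"])
         (auto simp: digit_mat_def one_mat2_def mult.assoc algebra_simps)
  next
    case False
    show ?thesis
      using assms w False
      by (intro exI[of _ "w0 @ [l - 1, 1, 1]"])
         (auto simp: digit_mat_def one_mat2_def mult.assoc algebra_simps)
  qed
qed

text \<open>For a Pell solution with \<open>p, q > 0\<close> this is \<open>1 / (z - s)\<close>,
  where \<open>z = (\<delta> + sqrt \<delta>) * q / p - 1\<close> is the larger fixed point of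
  \<open>U R U R'\<close>; passing from \<open>z\<close> to \<open>1 / (z - s)\<close> strips the
  leading digit \<open>s\<close>.\<close>

definition period_value :: "int \<Rightarrow> int \<Rightarrow> int \<Rightarrow> int \<Rightarrow> real" where
  "period_value \<delta> s p q = 1 / ((of_int \<delta> + sqrt (of_int \<delta>)) * (of_int q / of_int p) - 1 - of_int s)"

context pell
begin

lemma \<delta>_pos: "\<delta> \<ge> 1"
  using s_le s_pos by (smt (verit) zero_less_power)

text \<open>With denominators cleared, \<open>(S + 1) * P < r * Q * (r + 1)\<close> is needed. Since
  \<delta> is not a square, \<open>(r + 1)\<^sup>2\<close> exceeds \<open>(S + 1)\<^sup>2\<close> by
  at least 1; times \<open>r\<^sup>2 * Q\<^sup>2\<close> this outweighs the extra
  \<open>(S + 1)\<^sup>2\<close> coming from Pell's equation.\<close>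

lemma period_value_pos: "period_value \<delta> s p q > 0"
proof -
  define r where "r = sqrt (of_int \<delta>)"
  have r2: "r\<^sup>2 = of_int \<delta>" using \<delta>_pos by (simp add: r_def)
  have r0: "r \<ge> 0" using \<delta>_pos by (simp add: r_def)
  have "\<delta> \<noteq> s\<^sup>2" using nonsquare[of 1 s] by auto
  then have "s\<^sup>2 + 1 \<le> \<delta>" using s_le by simp
  then have "real_of_int (s\<^sup>2 + 1) \<le> of_int \<delta>" by (simp only: of_int_le_iff)
  then have sr: "(of_int s)\<^sup>2 + 1 \<le> r\<^sup>2" using r2 by simp
  define S :: real where "S = of_int s"
  define P :: real where "P = of_int p"
  define Q :: real where "Q = of_int q"
  have S: "S \<ge> 1" using s_pos by (simp add: S_def)
  have Q: "Q \<ge> 3" using q_ge by (simp add: Q_def)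
  have P: "P > 0" using p_pos by (simp add: P_def)
  have sr: "S\<^sup>2 + 1 \<le> r\<^sup>2" using sr by (simp add: S_def)
  have "real_of_int (p\<^sup>2 - \<delta> * q\<^sup>2) = 1" using pell by simp
  then have pell': "P\<^sup>2 = r\<^sup>2 * Q\<^sup>2 + 1" by (simp add: P_def Q_def r2)
  have "S\<^sup>2 \<le> r\<^sup>2" using sr by simp
  then have Sr: "S \<le> r" using r0 by (rule power2_le_imp_le)
  have gap: "(S + 1)\<^sup>2 + 1 \<le> (r + 1)\<^sup>2"
    using sr Sr by (simp add: power2_eq_square algebra_simps)
  have "(S + 1)\<^sup>2 \<le> 4 * S\<^sup>2"
    using S power_mono[of "S + 1" "2 * S" 2] by (simp add: power_mult_distrib)
  moreover have "S\<^sup>2 * 9 \<le> r\<^sup>2 * Q\<^sup>2"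
    using S Sr Q power_mono[of 3 Q 2] by (intro mult_mono power_mono) simp_all
  moreover have "0 < S\<^sup>2" using S by simp
  ultimately have "(S + 1)\<^sup>2 < r\<^sup>2 * Q\<^sup>2" by linarith
  moreover have "r\<^sup>2 * Q\<^sup>2 * ((S + 1)\<^sup>2 + 1) \<le> r\<^sup>2 * Q\<^sup>2 * (r + 1)\<^sup>2"
    using gap by (intro mult_left_mono) simp_all
  moreover have "((S + 1) * P)\<^sup>2 = r\<^sup>2 * Q\<^sup>2 * ((S + 1)\<^sup>2 + 1) - r\<^sup>2 * Q\<^sup>2 + (S + 1)\<^sup>2"
    unfolding power_mult_distrib pell' by (simp add: distrib_left)
  ultimately have "((S + 1) * P)\<^sup>2 < (r * Q * (r + 1))\<^sup>2"
    unfolding power_mult_distrib by linarith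
  moreover have "0 \<le> r * Q * (r + 1)" using r0 Q by simp
  ultimately have "(S + 1) * P < r * Q * (r + 1)" by (rule power2_less_imp_less)
  also have "r * Q * (r + 1) = (of_int \<delta> + r) * Q"
    unfolding r2[symmetric] by (simp add: power2_eq_square algebra_simps)
  finally have "S + 1 < (of_int \<delta> + r) * Q / P" using P by (simp add: pos_less_divide_eq)
  then show ?thesis
    unfolding period_value_def r_def S_def P_def Q_def by simp
qed

lemma period_value_in_quadratic_field: "period_value \<delta> s p q \<in> quadratic_field \<delta>"
proof -
  define r where "r = sqrt (of_int \<delta>)"
  have r2: "r\<^sup>2 = of_int \<delta>" using \<delta>_pos by (simp add: r_def)
  define u where "u = \<delta> * q - p - s * p"
  \<comment> \<open>The norm of \<open>u + q * sqrt \<delta>\<close>, used to rationalise the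
    denominator.\<close>
  define n where "n = u\<^sup>2 - \<delta> * q\<^sup>2"
  have "n \<noteq> 0" using nonsquare[of q u] q_ge by (simp add: n_def)
  then have n0: "real_of_int n \<noteq> 0" by simp
  have n: "real_of_int n = (of_int u + of_int q * r) * (of_int u - of_int q * r)"
    by (simp add: n_def r2[symmetric] power2_eq_square algebra_simps)
  then have nz: "of_int u + of_int q * r \<noteq> 0" "of_int u - of_int q * r \<noteq> 0" using n0 by auto
  have "(of_int \<delta> + r) * (of_int q / of_int p) - 1 - of_int s = (of_int u + of_int q * r) / of_int p"
    using p_pos by (simp add: u_def field_simps)
  then have "period_value \<delta> s p q = of_int p / (of_int u + of_int q * r)"
    by (simp add: period_value_def r_def)
  also have "\<dots> = of_int p * (of_int u - of_int q * r) / of_int n"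
    unfolding n using nz by simp
  also have "\<dots> = of_int (p * u) / of_int n + of_int (- p * q) / of_int n * r"
    by (simp add: algebra_simps diff_divide_distrib)
  finally have "period_value \<delta> s p q = of_int (p * u) / of_int n + of_int (- p * q) / of_int n * r" .
  moreover have "of_int (p * u) / of_int n \<in> (\<rat> :: real set)" "of_int (- p * q) / of_int n \<in> (\<rat> :: real set)"
    by (intro Rats_divide Rats_of_int)+
  ultimately show ?thesis
    unfolding quadratic_field_def r_def[symmetric] by blast
qed

text \<open>The period matrix is the conjugate of \<open>U R U R'\<close> by \<open>(0, 1; 1, -s)\<close>, where
  \<open>R = (-1, 0; 2, 1)\<close> and \<open>R' = (1, 2; 0, -1)\<close>.\<close>

lemma period_value_fixed:
  assumes W: "word_mat W = core * word_mat [s - 1, 1, 1, s] * (core * Mat2 2 1 (-1) 0)"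
    and digits: "\<forall>x\<in>set W. 1 \<le> x"
  shows "cfrac_apply W (period_value \<delta> s p q) = period_value \<delta> s p q"
proof -
  define x where "x = period_value \<delta> s p q"
  define r where "r = sqrt (of_int \<delta>)"
  have r2: "of_int \<delta> = r * r" using \<delta>_pos by (simp add: r_def)
  have x: "x > 0" using period_value_pos by (simp add: x_def)
  obtain A B C D where m: "word_mat W = Mat2 A B C D" by (cases "word_mat W")
  have AC: "A \<ge> 1" "C \<ge> 0" "D \<ge> 0" "C + D \<ge> 1" using word_mat_props[OF m digits] by auto
  have pos: "of_int C * x + of_int D > 0"
  proof (cases "C = 0")
    case False
    then have "of_int C * x > 0" using AC x by simp
    then show ?thesis using AC by (simp add: add_pos_nonneg)
  qed (use AC in simp)
  define t where "t = (r * r + r) * of_int q - of_int p - of_int s * of_int p"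
  have P: "real_of_int p > 0" using p_pos by simp
  have "x = 1 / ((r * r + r) * (of_int q / of_int p) - 1 - of_int s)"
    by (simp only: x_def period_value_def r_def[symmetric] r2[symmetric])
  also have "\<dots> = of_int p / t"
    using P by (simp add: t_def field_simps)
  finally have "x = of_int p / t" .
  then have t: "t > 0" "t * x = of_int p" using x P by (auto simp: zero_less_divide_iff)
  have entries:
    "A = \<delta> * q\<^sup>2 + 3 * p\<^sup>2 + 2 * s * p\<^sup>2 - 2 * \<delta> * p * q"
    "B = 2 * p\<^sup>2"
    "C = 2 * \<delta> * q\<^sup>2 + 4 * \<delta> * p * q + 4 * \<delta> * s * p * q - 2 * p\<^sup>2 - 4 * s * p\<^sup>2
      - 2 * (\<delta> * q)\<^sup>2 - 2 * (s * p)\<^sup>2"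
    "D = \<delta> * q\<^sup>2 + 2 * \<delta> * p * q - p\<^sup>2 - 2 * s * p\<^sup>2"
    using W unfolding m core_def
    by (simp_all add: digit_mat_def one_mat2_def power2_eq_square algebra_simps)
  \<comment> \<open>The fixed-point equation at \<open>x = p / t\<close>, multiplied by
    \<open>t\<^sup>2\<close>, becomes a polynomial identity in \<open>p\<close>, \<open>q\<close>,
    \<open>s\<close> and \<open>r\<close>.\<close>
  have "real_of_int C * (of_int p)\<^sup>2 + of_int (D - A) * of_int p * t - of_int B * t\<^sup>2 = 0"
    unfolding entries t_def by (simp add: r2 power2_eq_square algebra_simps)
  then have "t\<^sup>2 * (of_int C * x\<^sup>2 + of_int (D - A) * x - of_int B) = 0"
    unfolding t(2)[symmetric] by (simp add: power2_eq_square algebra_simps)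
  then have "of_int C * x\<^sup>2 + of_int (D - A) * x - of_int B = 0" using t(1) by simp
  then have "of_int A * x + of_int B = x * (of_int C * x + of_int D)"
    by (simp add: power2_eq_square algebra_simps)
  then have "cfrac_apply W x = x"
    using cfrac_apply_word_mat[OF m digits x] pos by simp
  then show ?thesis by (simp add: x_def)
qed

lemma period_value_periodic:
  "\<exists>as. has_periodic_cfrac (period_value \<delta> s p q) as \<and> (\<forall>a\<in>set as. 1 \<le> a \<and> a \<le> 4 * s + 1)"
proof -
  obtain w where w: "word_mat w = core" "\<forall>x\<in>set w. 1 \<le> x" using ex_core_word by blast
  have digits: "\<forall>x\<in>set w. 1 \<le> x \<and> x \<le> 2 * s + 2" using w core_word_digit_le by blast
  have ne: "w \<noteq> []" "w \<noteq> [1]"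
    using w(1) q_ge by (auto simp: core_def digit_mat_def one_mat2_def)
  obtain w1 where w1: "word_mat w1 = core * word_mat [s - 1, 1, 1, s]" "w1 \<noteq> []"
      "\<forall>x\<in>set w1. 1 \<le> x \<and> x \<le> 2 * s + 2 + 1"
    using ex_word_first_turn[OF ne(1) digits s_pos] s_pos w(1) by auto
  obtain w2 where w2: "word_mat w2 = core * Mat2 2 1 (-1) 0"
      "\<forall>x\<in>set w2. 1 \<le> x \<and> x \<le> 2 * s + 2 + 1"
    using ex_word_second_turn[OF digits ne] w(1) by auto
  \<comment> \<open>\<open>2 * s + 3 \<le> 4 * s + 1\<close> because \<open>s \<ge> 1\<close>, with
    equality for \<open>s = 1\<close>.\<close>
  have bounds: "\<forall>x\<in>set (w1 @ w2). 1 \<le> x \<and> x \<le> 4 * s + 1"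
    using w1(3) w2(2) s_pos by fastforce
  have "word_mat (w1 @ w2) = core * word_mat [s - 1, 1, 1, s] * (core * Mat2 2 1 (-1) 0)"
    using w1(1) w2(1) by (simp only: word_mat_append)
  then have "cfrac_apply (w1 @ w2) (period_value \<delta> s p q) = period_value \<delta> s p q"
    using bounds by (intro period_value_fixed) auto
  then have "has_periodic_cfrac (period_value \<delta> s p q) (w1 @ w2)"
    using w1(2) bounds period_value_pos by (intro has_periodic_cfracI) auto
  then show ?thesis using bounds by blast
qed

end

section \<open>Pell's equation\<close>

text \<open>Dirichlet's theorem gives \<open>\<bar>k * r - h\<bar> < 1 / (N + 1)\<close> with
  \<open>k \<le> N + 1\<close>, hence norm at most \<open>2 * r + 1\<close>. Finitely many pairs
  would keep this distance away from 0.\<close>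

lemma infinite_small_norm:
  fixes \<delta> :: int
  assumes nonsquare: "\<And>h k. k \<noteq> 0 \<Longrightarrow> h\<^sup>2 \<noteq> \<delta> * k\<^sup>2" and \<delta>: "\<delta> \<ge> 1"
  shows "infinite {(h, k). h > 0 \<and> k > 0 \<and> \<bar>h\<^sup>2 - \<delta> * k\<^sup>2\<bar> \<le> 2 * \<delta> + 1}" (is "infinite ?S")
proof
  assume fin: "finite ?S"
  define r where "r = sqrt (of_int \<delta>)"
  have r2: "r\<^sup>2 = of_int \<delta>" using \<delta> by (simp add: r_def)
  have r1: "r \<ge> 1" using \<delta> by (simp add: r_def)
  have rle: "r \<le> of_int \<delta>"
    using r1 mult_left_mono[of 1 r r] by (simp add: r2[symmetric] power2_eq_square)
  define g where "g = (\<lambda>(h::int, k::int). \<bar>of_int k * r - of_int h\<bar>)"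
  have gpos: "g (h, k) > 0" if "k > 0" for h k
  proof -
    have "of_int k * r \<noteq> of_int h"
    proof
      assume "of_int k * r = of_int h"
      then have "(of_int h)\<^sup>2 = (of_int k)\<^sup>2 * r\<^sup>2" by (metis power_mult_distrib)
      then have "real_of_int (h\<^sup>2) = of_int (\<delta> * k\<^sup>2)" by (simp add: r2)
      then show False using nonsquare[of k h] that by (simp only: of_int_eq_iff)
    qed
    then show ?thesis by (simp add: g_def)
  qed
  \<comment> \<open>The inserted 1 makes the set nonempty, so that \<open>Min\<close> is
    meaningful.\<close>
  define m where "m = Min (insert 1 (g ` ?S))"
  have "m > 0" unfolding m_def using fin gpos by (subst Min_gr_iff) auto
  then obtain N :: nat where N: "1 / real (Suc N) < m"
    using reals_Archimedean[of m] by (auto simp: inverse_eq_divide)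
  obtain h k where hk: "0 < k" "k \<le> int (Suc N)" "\<bar>of_int k * r - of_int h\<bar> < 1 / real (Suc N)"
    by (metis Dirichlet_approx zero_less_Suc)
  have "1 / real (Suc N) \<le> 1" by simp
  then have d1: "\<bar>of_int k * r - of_int h\<bar> < 1" using hk(3) by linarith
  have "1 * 1 \<le> of_int k * r" using hk(1) r1 by (intro mult_mono) auto
  then have h0: "real_of_int h > 0" using d1 by linarith
  have "\<bar>(of_int h)\<^sup>2 - r\<^sup>2 * (of_int k)\<^sup>2\<bar> = \<bar>of_int k * r - of_int h\<bar> * (of_int k * r + of_int h)"
  proof -
    have "(of_int h)\<^sup>2 - r\<^sup>2 * (of_int k)\<^sup>2 = - ((of_int k * r - of_int h) * (of_int k * r + of_int h))"
      by (simp add: power2_eq_square algebra_simps)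
    then show ?thesis using h0 r1 hk(1) by (simp add: abs_mult)
  qed
  also have "\<dots> \<le> 1 / real (Suc N) * (2 * r * of_int k + 1)"
    using hk d1 h0 r1 by (intro mult_mono) (auto simp: algebra_simps)
  also have "\<dots> \<le> 1 / real (Suc N) * (2 * r * real (Suc N) + real (Suc N))"
  proof -
    have "real_of_int k \<le> of_int (int (Suc N))" using hk(2) by (simp only: of_int_le_iff)
    then have "2 * r * of_int k \<le> 2 * r * real (Suc N)" using r1 by (intro mult_left_mono) auto
    then show ?thesis by (intro mult_left_mono) auto
  qed
  also have "\<dots> = 2 * r + 1" by (simp add: field_simps)
  also have "\<dots> \<le> 2 * of_int \<delta> + 1" using rle by simp
  finally have "real_of_int \<bar>h\<^sup>2 - \<delta> * k\<^sup>2\<bar> \<le> of_int (2 * \<delta> + 1)" by (simp add: r2)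
  then have "\<bar>h\<^sup>2 - \<delta> * k\<^sup>2\<bar> \<le> 2 * \<delta> + 1" by (simp only: of_int_le_iff)
  then have "(h, k) \<in> ?S" using hk(1) h0 by simp
  then have "m \<le> g (h, k)" unfolding m_def using fin by (intro Min_le) auto
  then show False using N hk(3) by (simp add: g_def)
qed

text \<open>By pigeonhole two distinct pairs share the norm \<open>N\<close> and are congruent
  modulo \<open>N\<close>; the quotient of the corresponding elements is then integral of norm
  1.\<close>

lemma ex_pell_solution:
  fixes \<delta> :: int
  assumes nonsquare: "\<And>h k. k \<noteq> 0 \<Longrightarrow> h\<^sup>2 \<noteq> \<delta> * k\<^sup>2" and \<delta>: "\<delta> \<ge> 1"
  shows "\<exists>p q. p > 0 \<and> q > 0 \<and> p\<^sup>2 - \<delta> * q\<^sup>2 = 1"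
proof -
  define c where "c = 2 * \<delta> + 1"
  define S where "S = {(h, k). h > 0 \<and> k > 0 \<and> \<bar>h\<^sup>2 - \<delta> * k\<^sup>2\<bar> \<le> c}"
  have inf: "infinite S" using infinite_small_norm[OF assms] by (simp add: S_def c_def)
  define n where "n = (\<lambda>(h, k). h\<^sup>2 - \<delta> * k\<^sup>2)"
  define f where "f z = (n z, fst z mod n z, snd z mod n z)" for z
  have n0: "n (h, k) \<noteq> 0" if "k > 0" for h k using nonsquare[of k h] that by (simp add: n_def)
  have "f ` S \<subseteq> {-c..c} \<times> {-c..c} \<times> {-c..c}"
  proof (rule image_subsetI)
    fix z assume "z \<in> S"
    moreover obtain h k where z: "z = (h, k)" by (cases z)
    ultimately have le: "\<bar>n z\<bar> \<le> c" and "n z \<noteq> 0" using n0 by (auto simp: S_def n_def)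
    then have "\<bar>i mod n z\<bar> \<le> c" for i using abs_mod_less[of "n z" i] by linarith
    then show "f z \<in> {-c..c} \<times> {-c..c} \<times> {-c..c}"
      using le by (auto simp: f_def abs_le_iff minus_le_iff)
  qed
  then have "finite (f ` S)" by (rule finite_subset) auto
  then obtain z where z: "z \<in> S" "infinite {y \<in> S. f y = f z}"
    using pigeonhole_infinite[OF inf] by blast
  then have "infinite ({y \<in> S. f y = f z} - {z})" by simp
  then have "{y \<in> S. f y = f z} - {z} \<noteq> {}" by (metis finite.emptyI)
  then obtain y where y: "y \<in> S" "f y = f z" "y \<noteq> z" by blast
  obtain h1 k1 where z1: "z = (h1, k1)" by (cases z)
  obtain h2 k2 where y2: "y = (h2, k2)" by (cases y)
  define N where "N = n z"
  have pos: "h1 > 0" "k1 > 0" "h2 > 0" "k2 > 0" using z(1) y(1) by (auto simp: S_def z1 y2)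
  have N1: "h1\<^sup>2 - \<delta> * k1\<^sup>2 = N" by (simp add: N_def n_def z1)
  have N2: "h2\<^sup>2 - \<delta> * k2\<^sup>2 = N" using y(2) by (simp add: N_def f_def) (simp add: n_def y2)
  have N0: "N \<noteq> 0" using n0 pos by (simp add: N_def z1)
  have "h2 mod N = h1 mod N" "k2 mod N = k1 mod N"
    using y(2) by (auto simp: N_def f_def z1 y2)
  then obtain i j where ij: "h2 = h1 + N * i" "k2 = k1 + N * j"
    by (metis mod_eqE)
  \<comment> \<open>\<open>N * a\<close> and \<open>N * b\<close> are the coordinates of
    \<open>(h1 - k1 * sqrt \<delta>) * (h2 + k2 * sqrt \<delta>)\<close>; the congruences make them
    divisible by \<open>N\<close>.\<close>
  define a b where "a = 1 + h1 * i - \<delta> * k1 * j" and "b = h1 * j - k1 * i"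
  have X: "h1 * h2 - \<delta> * k1 * k2 = N * a"
    unfolding ij a_def using N1 by (simp add: power2_eq_square algebra_simps)
  have Y: "h1 * k2 - h2 * k1 = N * b"
    unfolding ij b_def by (simp add: algebra_simps)
  have "N\<^sup>2 * (a\<^sup>2 - \<delta> * b\<^sup>2) = (N * a)\<^sup>2 - \<delta> * (N * b)\<^sup>2"
    by (simp add: power2_eq_square algebra_simps)
  also have "\<dots> = (h1\<^sup>2 - \<delta> * k1\<^sup>2) * (h2\<^sup>2 - \<delta> * k2\<^sup>2)"
    unfolding X[symmetric] Y[symmetric] by (simp add: power2_eq_square algebra_simps)
  also have "\<dots> = N\<^sup>2 * 1" unfolding N1 N2 by (simp add: power2_eq_square)
  finally have ab: "a\<^sup>2 - \<delta> * b\<^sup>2 = 1" using N0 by simp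
  \<comment> \<open>Otherwise the two pairs would be proportional with equal norm, hence
    equal.\<close>
  have "b \<noteq> 0"
  proof
    assume "b = 0"
    then have cross: "h1 * k2 = h2 * k1" using Y by simp
    have "N * k2\<^sup>2 = (h1 * k2)\<^sup>2 - \<delta> * k1\<^sup>2 * k2\<^sup>2"
      unfolding N1[symmetric] by (simp add: power2_eq_square algebra_simps)
    also have "\<dots> = N * k1\<^sup>2"
      unfolding cross N2[symmetric] by (simp add: power2_eq_square algebra_simps)
    finally have "k2\<^sup>2 = k1\<^sup>2" using N0 by simp
    then have "k2 = k1" using pos by (simp add: power2_eq_iff_nonneg)
    then show False using cross pos y(3) by (simp add: z1 y2)
  qed
  moreover have "a \<noteq> 0"
  proof
    assume "a = 0"
    moreover have "\<delta> * b\<^sup>2 \<ge> 0" using \<delta> by simp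
    ultimately show False using ab by simp
  qed
  ultimately show ?thesis using ab by (intro exI[of _ "\<bar>a\<bar>"] exI[of _ "\<bar>b\<bar>"]) simp
qed

lemma infinite_pell_solutions:
  fixes \<delta> m :: int
  assumes nonsquare: "\<And>h k. k \<noteq> 0 \<Longrightarrow> h\<^sup>2 \<noteq> \<delta> * k\<^sup>2" and \<delta>: "\<delta> \<ge> 1"
  shows "infinite {(p, q). p > 0 \<and> q \<ge> m \<and> p\<^sup>2 - \<delta> * q\<^sup>2 = 1}" (is "infinite ?S")
proof
  assume "finite ?S"
  then have "bdd_above (snd ` ?S)" by (intro bdd_above_finite) auto
  then obtain B where B: "\<And>p q. p > 0 \<Longrightarrow> q \<ge> m \<Longrightarrow> p\<^sup>2 - \<delta> * q\<^sup>2 = 1 \<Longrightarrow> q \<le> B"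
    unfolding bdd_above_def by fastforce
  have "\<exists>p q. p > 0 \<and> q > int n \<and> p\<^sup>2 - \<delta> * q\<^sup>2 = 1" for n
  proof (induction n)
    case 0
    then show ?case using ex_pell_solution[OF assms] by simp
  next
    case (Suc n)
    then obtain p q where pq: "p > 0" "q > int n" "p\<^sup>2 - \<delta> * q\<^sup>2 = 1" by blast
    \<comment> \<open>Squaring \<open>p + q * sqrt \<delta>\<close> gives a solution with larger
      \<open>q\<close>.\<close>
    have "(p\<^sup>2 + \<delta> * q\<^sup>2)\<^sup>2 - \<delta> * (2 * p * q)\<^sup>2 = (p\<^sup>2 - \<delta> * q\<^sup>2)\<^sup>2"
      by (simp add: power2_eq_square algebra_simps)
    moreover have "p\<^sup>2 + \<delta> * q\<^sup>2 > 0" using pq \<delta> by (simp add: add_pos_nonneg)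
    moreover have "1 * q \<le> p * q" using pq by (intro mult_right_mono) auto
    then have "int (Suc n) < 2 * p * q" using pq by linarith
    ultimately show ?case using pq(3) by (metis one_power2)
  qed
  from this[of "nat (max m B)"] show False
    using B by (smt (verit, best) nat_0_le int_nat_eq)
qed

text \<open>The value determines \<open>q / p\<close>, and with
  \<open>p\<^sup>2 = 1 + \<delta> * q\<^sup>2\<close> this ratio determines
  \<open>q\<^sup>2\<close>.\<close>

lemma inj_on_period_value:
  assumes \<delta>: "\<delta> \<ge> 1"
  shows "inj_on (\<lambda>(p, q). period_value \<delta> s p q) {(p, q). p > 0 \<and> q \<ge> 0 \<and> p\<^sup>2 - \<delta> * q\<^sup>2 = 1}"
proof (rule inj_onI, clarify)
  fix p q p' q' :: int
  assume pos: "p > 0" "q \<ge> 0" "p' > 0" "q' \<ge> 0"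
    and pell: "p\<^sup>2 - \<delta> * q\<^sup>2 = 1" "p'\<^sup>2 - \<delta> * q'\<^sup>2 = 1"
    and eq: "period_value \<delta> s p q = period_value \<delta> s p' q'"
  define c where "c = of_int \<delta> + sqrt (of_int \<delta>)"
  have "c > 0" using \<delta> by (simp add: c_def add_pos_pos)
  moreover have "c * (of_int q / of_int p) = c * (of_int q' / of_int p')"
    using eq by (simp add: period_value_def c_def)
  ultimately have "real_of_int q / of_int p = of_int q' / of_int p'"
    by (metis mult_left_cancel order_less_irrefl)
  then have "real_of_int (q * p') = of_int (q' * p)" using pos by (simp add: field_simps)
  then have "q * p' = q' * p" by (simp only: of_int_eq_iff)
  then have "q\<^sup>2 * p'\<^sup>2 = q'\<^sup>2 * p\<^sup>2" by (metis power_mult_distrib)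
  moreover have "p\<^sup>2 = 1 + \<delta> * q\<^sup>2" "p'\<^sup>2 = 1 + \<delta> * q'\<^sup>2" using pell by simp_all
  ultimately have sq: "q\<^sup>2 = q'\<^sup>2" by (simp add: algebra_simps)
  then have "p\<^sup>2 = p'\<^sup>2" using pell by simp
  then show "p = p' \<and> q = q'" using sq pos by (simp add: power2_eq_iff_nonneg)
qed

theorem mainTheorem7:
  fixes \<delta> :: int
  assumes "\<delta> \<ge> 2" and "squarefree \<delta>"
  shows "infinite {x \<in> quadratic_field \<delta>.
           \<exists>as. has_periodic_cfrac x as \<and>
                (\<forall>a\<in>set as. 1 \<le> a \<and> a \<le> 4 * \<lfloor>sqrt (of_int \<delta>)\<rfloor> + 1)}"
proof -
  define s where "s = \<lfloor>sqrt (of_int \<delta>)\<rfloor>"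
  define S where "S = {(p, q). p > 0 \<and> q \<ge> 3 \<and> p\<^sup>2 - \<delta> * q\<^sup>2 = 1}"
  have nonsquare: "h\<^sup>2 \<noteq> \<delta> * k\<^sup>2" if "k \<noteq> 0" for h k :: int
    using squarefree_imp_not_square_ratio[OF assms that] .
  have s: "real_of_int s \<le> sqrt (of_int \<delta>)" "sqrt (of_int \<delta>) < of_int s + 1"
    by (simp_all add: s_def)
  have s1: "s \<ge> 1" using assms(1) by (simp add: s_def le_floor_iff)
  have "(real_of_int s)\<^sup>2 \<le> of_int \<delta>"
    using power_mono[OF s(1), of 2] s1 assms(1) by simp
  then have "real_of_int (s\<^sup>2) \<le> of_int \<delta>" by simp
  then have le: "s\<^sup>2 \<le> \<delta>" by (simp only: of_int_le_iff)
  have "of_int \<delta> < (real_of_int s + 1)\<^sup>2"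
    using power_strict_mono[OF s(2), of 2] assms(1) by simp
  then have "real_of_int \<delta> < of_int ((s + 1)\<^sup>2)" by simp
  then have less: "\<delta> < (s + 1)\<^sup>2" by (simp only: of_int_less_iff)
  have pell: "pell \<delta> s p q" if "(p, q) \<in> S" for p q
    using that nonsquare s1 le less unfolding S_def by unfold_locales auto
  have "infinite S"
    unfolding S_def using assms(1) by (intro infinite_pell_solutions nonsquare) auto
  moreover have "inj_on (\<lambda>(p, q). period_value \<delta> s p q) S"
    using assms(1) by (intro inj_on_subset[OF inj_on_period_value]) (auto simp: S_def)
  ultimately have "infinite ((\<lambda>(p, q). period_value \<delta> s p q) ` S)"
    by (simp add: finite_image_iff)
  moreover have "(\<lambda>(p, q). period_value \<delta> s p q) ` S \<subseteq> {x \<in> quadratic_field \<delta>.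
      \<exists>as. has_periodic_cfrac x as \<and> (\<forall>a\<in>set as. 1 \<le> a \<and> a \<le> 4 * s + 1)}"
    using pell.period_value_in_quadratic_field[OF pell] pell.period_value_periodic[OF pell]
    by auto
  ultimately show ?thesis unfolding s_def using finite_subset by blast
qed

end
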